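(* Suppose that $\mathbf X$ satisfies the short-time density bound and the local uniform transition density convergence condition (both defined in the context), and let $f:\mathbb R^d\to\mathbb R$ be a bounded measurable function with compact support $\mathcal S$ fulfilling $\boldsymbol\lambda(\mathcal S)<1$. Then there exists a constant $C>0$ such that, for any $T>0$, $$\mathrm{Var}\Big(\int_0^T f(X_t)\,dt\Big)\le C(1\vee c_{\mathcal S})\,T\,\|f\|_\infty^2\,\boldsymbol\lambda(\mathcal S)\,\mu(\mathcal S)\,\psi_d^2(\boldsymbol\lambda(\mathcal S)),$$ where $$\psi_d(x)=\begin{cases}1,&d=1,\\ \sqrt{1+\log(1/x)},&d=2,\\ x^{\frac1d-\frac12},&d\ge3,\end{cases}$$ and the variance is taken with respect to $\mathbb P=\mathbb P^\mu$.
   Context: $\mathbf X=(X_t)_{t\ge 0}$ with laws $(\mathbb P^x)_{x\in\mathbb R^d}$ is a non-explosive Borel right Markov process with state space $(\mathbb R^d,\mathcal B(\mathbb R^d))$ and semigroup $P_t(x,B)=\mathbb P^x(X_t\in B)$. Standing assumption: for any $t>0$, $x\in\mathbb R^d$ there is a measurable transition density $p_t:\mathbb R^d\times\mathbb R^d\to\mathbb R_+$ with $P_t(x,B)=\int_B p_t(x,y)\,dy$ for all Borel $B$, and $\mathbf X$ admits a unique invariant probability measure $\mu$, which is absolutely continuous with density $\rho:\mathbb R^d\to\mathbb R_+$. $\mathbb P=\mathbb P^\mu$ denotes the law of $\mathbf X$ with $X_0\sim\mu$. $\boldsymbol\lambda$ is Lebesgue measure on $\mathbb R^d$. A Borel set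 $B$ is $\mu$-full if $\mu(B)=1$. Short-time density bound: if $d=1$, there is a non-negative measurable function $\alpha:(0,1]\to\mathbb R_+$ such that $\sup_{x,y\in\mathbb R}p_t(x,y)\le\alpha(t)$ for all $t\in(0,1]$ and $\int_{0+}^1\alpha(t)\,dt<\infty$; if $d\ge2$, there is $c_2>0$ such that $\sup_{x,y\in\mathbb R^d}p_t(x,y)\le c_2t^{-d/2}$ for all $t\in(0,1]$. Local uniform transition density convergence condition: there is a $\mu$-full set $\Lambda$ such that for any compact $\mathcal S\subset\mathbb R^d$ there is a non-negative measurable function $r_{\mathcal S}:(0,\infty)\to\mathbb R_+$ with $\sup_{x\in\mathcal S\cap\Lambda,\,y\in\mathcal S}|p_t(x,y)-\rho(y)|\le r_{\mathcal S}(t)$ for all $t>1$ and $\int_1^\infty r_{\mathcal S}(t)\,dt=c_{\mathcal S}<\infty$. *)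

theory Defs
  imports "HOL-Probability.Probability"
begin

definition observed :: "'w set \<Rightarrow> (real \<Rightarrow> 'w \<Rightarrow> 'a::topological_space) \<Rightarrow> real set \<Rightarrow> 'w measure" where
  "observed W X I = sigma W {X s -` B \<inter> W | s B. s \<in> I \<and> B \<in> sets borel}"

definition transition ::
  "(real \<Rightarrow> 'w \<Rightarrow> 'a::topological_space) \<Rightarrow> ('a \<Rightarrow> 'w measure) \<Rightarrow> real \<Rightarrow> 'a \<Rightarrow> 'a measure" where
  "transition X P t x = distr (P x) borel (X t)"

definition universally_measurable :: "('a::topological_space \<Rightarrow> ennreal) \<Rightarrow> bool" where
  "universally_measurable f \<longleftrightarrow>
    (\<forall>\<nu>. finite_measure \<nu> \<and> sets \<nu> = sets borel \<longrightarrow> f \<in> borel_measurable (completion \<nu>))"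

text \<open>
  In the next two definitions \<open>K t x\<close> is a transition kernel on the Borel sets. Since excessive
  functions are only required to be universally measurable, they are integrated against the
  completion of \<open>K t x\<close>.
\<close>

definition kernel_apply ::
  "(real \<Rightarrow> 'a \<Rightarrow> 'a measure) \<Rightarrow> real \<Rightarrow> ('a \<Rightarrow> ennreal) \<Rightarrow> 'a \<Rightarrow> ennreal" where
  "kernel_apply K t f x = (\<integral>\<^sup>+ y. f y \<partial>completion (K t x))"

definition excessive ::
  "(real \<Rightarrow> 'a \<Rightarrow> 'a measure) \<Rightarrow> real \<Rightarrow> ('a::topological_space \<Rightarrow> ennreal) \<Rightarrow> bool" where
  "excessive K \<alpha> f \<longleftrightarrow>
    universally_measurable f \<and>
    (\<forall>t\<ge>0. \<forall>x. ennreal (exp (- \<alpha> * t)) * kernel_apply K t f x \<le> f x) \<and>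
    (\<forall>x. ((\<lambda>t. ennreal (exp (- \<alpha> * t)) * kernel_apply K t f x) \<longlongrightarrow> f x) (at_right 0))"

text \<open>
  Borel right processes in the sense of Sharpe (General Theory of Markov Processes):
  a right-continuous normal Markov process such that, under every initial law, \<open>f (X t)\<close> is almost
  surely right-continuous for every \<open>\<alpha>\<close>-excessive \<open>f\<close>, and whose semigroup is Borel. This implies
  the strong Markov property. The laws \<open>P x\<close> live on the uncompleted sigma-algebra generated
  by the process, and the Markov property is stated for the natural filtration. Non-explosion is
  the absence of a cemetery state: every \<open>P x\<close> is a probability measure, and \<open>X t\<close> takes values in
  the state space for all \<open>t \<ge> 0\<close>. Only times \<open>t \<ge> 0\<close> matter.
\<close>

locale borel_right_process =
  fixes W :: "'w set"
    and X :: "real \<Rightarrow> 'w \<Rightarrow> 'a::euclidean_space"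
    and P :: "'a \<Rightarrow> 'w measure"
  assumes laws: "P \<in> borel \<rightarrow>\<^sub>M prob_algebra (observed W X {0..})"
    and right_continuous:
      "\<And>\<omega> t. \<omega> \<in> W \<Longrightarrow> 0 \<le> t \<Longrightarrow> continuous (at_right t) (\<lambda>s. X s \<omega>)"
    and normal: "\<And>x. AE \<omega> in P x. X 0 \<omega> = x"
    and markov:
      "\<And>x s t B. 0 \<le> s \<Longrightarrow> 0 \<le> t \<Longrightarrow> B \<in> sets borel \<Longrightarrow>
        AE \<omega> in P x. real_cond_exp (P x) (observed W X {0..s}) (\<lambda>\<omega>. indicator B (X (s + t) \<omega>)) \<omega>
          = measure (transition X P t (X s \<omega>)) B"
    and excessive_right_continuous:
      "\<And>\<nu> \<alpha> f. prob_space \<nu> \<Longrightarrow> sets \<nu> = sets borel \<Longrightarrow> 0 \<le> \<alpha> \<Longrightarrow>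
        excessive (transition X P) \<alpha> f \<Longrightarrow>
        AE \<omega> in \<nu> \<bind> P. \<forall>t\<ge>0. continuous (at_right t) (\<lambda>s. f (X s \<omega>))"

definition transition_density ::
  "(real \<Rightarrow> 'a::euclidean_space \<Rightarrow> 'a measure) \<Rightarrow> (real \<Rightarrow> 'a \<Rightarrow> 'a \<Rightarrow> real) \<Rightarrow> bool" where
  "transition_density K p \<longleftrightarrow>
    (\<forall>t>0. (\<lambda>(x, y). p t x y) \<in> borel_measurable (borel \<Otimes>\<^sub>M borel) \<and>
      (\<forall>x y. 0 \<le> p t x y) \<and>
      (\<forall>x. \<forall>B\<in>sets borel. emeasure (K t x) B = (\<integral>\<^sup>+ y\<in>B. ennreal (p t x y) \<partial>lborel)))"

definition invariant_law ::
  "(real \<Rightarrow> 'a::euclidean_space \<Rightarrow> 'a measure) \<Rightarrow> 'a measure \<Rightarrow> bool" where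
  "invariant_law K \<nu> \<longleftrightarrow>
    prob_space \<nu> \<and> sets \<nu> = sets borel \<and>
    (\<forall>t\<ge>0. \<forall>B\<in>sets borel. (\<integral>\<^sup>+ x. emeasure (K t x) B \<partial>\<nu>) = emeasure \<nu> B)"

definition short_time_density_bound :: "(real \<Rightarrow> 'a::euclidean_space \<Rightarrow> 'a \<Rightarrow> real) \<Rightarrow> bool" where
  "short_time_density_bound p \<longleftrightarrow>
    (DIM('a) = 1 \<longrightarrow>
      (\<exists>\<alpha>::real \<Rightarrow> real. set_borel_measurable borel {0<..1} \<alpha> \<and> (\<forall>t\<in>{0<..1}. 0 \<le> \<alpha> t) \<and>
        (\<forall>t\<in>{0<..1}. \<forall>x y. p t x y \<le> \<alpha> t) \<and> set_integrable lborel {0<..1} \<alpha>)) \<and>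
    (DIM('a) \<ge> 2 \<longrightarrow>
      (\<exists>c\<^sub>2>0. \<forall>t\<in>{0<..1}. \<forall>x y. p t x y \<le> c\<^sub>2 * t powr (- real DIM('a) / 2)))"

text \<open>
  The witnesses \<open>\<Lambda>\<close> and \<open>r\<close> are parameters because the constants \<open>c\<^sub>S = \<integral>\<^sub>1\<^sup>\<infinity> r\<^sub>S(t) dt\<close> derived
  from \<open>r\<close> occur in the variance bound.
\<close>

definition local_uniform_density_convergence ::
  "'a::euclidean_space measure \<Rightarrow> ('a \<Rightarrow> real) \<Rightarrow> (real \<Rightarrow> 'a \<Rightarrow> 'a \<Rightarrow> real) \<Rightarrow>
    'a set \<Rightarrow> ('a set \<Rightarrow> real \<Rightarrow> real) \<Rightarrow> bool" where
  "local_uniform_density_convergence \<mu> \<rho> p \<Lambda> r \<longleftrightarrow>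
    \<Lambda> \<in> sets borel \<and> emeasure \<mu> \<Lambda> = 1 \<and>
    (\<forall>S. compact S \<longrightarrow>
      set_borel_measurable borel {0<..} (r S) \<and> (\<forall>t>0. 0 \<le> r S t) \<and>
      (\<forall>t>1. \<forall>x\<in>S \<inter> \<Lambda>. \<forall>y\<in>S. \<bar>p t x y - \<rho> y\<bar> \<le> r S t) \<and>
      set_integrable lborel {1<..} (r S))"

definition convergence_constant :: "('a set \<Rightarrow> real \<Rightarrow> real) \<Rightarrow> 'a set \<Rightarrow> real" where
  "convergence_constant r S = (LINT t:{1<..}|lborel. r S t)"

text \<open>
  Only used for \<open>x \<in> [0,1)\<close>; the value at \<open>x = 0\<close> is irrelevant, because the bound carries
  a further factor \<open>x\<close> and \<open>x * (psi d x)\<^sup>2\<close> tends to \<open>0\<close> as \<open>x\<close> decreases to \<open>0\<close>.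
\<close>

definition psi :: "nat \<Rightarrow> real \<Rightarrow> real" where
  "psi d x = (if d = 1 then 1
    else if d = 2 then sqrt (1 + ln (1 / x))
    else x powr (1 / real d - 1 / 2))"

end

theory Submission
  imports Defs
begin

text \<open>
  Write \<open>m = \<mu>(f)\<close>, \<open>M = \<parallel>f\<parallel>\<^sub>\<infinity>\<close> and \<open>l = \<lambda>(S)\<close>, and let \<open>c(s, t)\<close> be the covariance of
  \<open>f(X\<^sub>s)\<close> and \<open>f(X\<^sub>t)\<close> under the stationary law. Fubini turns the variance of the time integral
  into the double integral of \<open>c\<close> over \<open>[0,T]\<^sup>2\<close> (\<open>variance_time_integral\<close>). If \<open>c(s, t) \<le> G(\<bar>t - s\<bar>)\<close>,
  this double integral is at most \<open>2 T\<close> times the integral of \<open>G\<close> over \<open>(0,\<infinity>)\<close>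
  (\<open>integral_difference_kernel_le\<close>). It remains to find a \<open>G\<close> of the right integral. By
  stationarity and the Markov property, \<open>(X\<^sub>s, X\<^sub>s\<^sub>+\<^sub>v)\<close> has the law \<open>\<mu>(dx) p\<^sub>v(x,y) dy\<close>.

  For lags \<open>v \<le> 1\<close> the covariance is at most the uncentred correlation, because only an upper
  bound is needed and the centring term is \<open>- m\<^sup>2 \<le> 0\<close>. Both endpoints must lie in \<open>S\<close>, so the
  correlation is at most \<open>M\<^sup>2 \<mu>(S)\<close> times any bound \<open>h(v)\<close> of \<open>P\<^sub>v(x, S)\<close> over \<open>x\<close>
  (\<open>correlation_le_kernel_bound\<close>). Two such bounds exist: the trivial \<open>1\<close>, and \<open>l\<close> times
  the supremum of \<open>p\<^sub>v\<close>. In dimension one the second is integrable over \<open>(0,1]\<close>. In dimension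
  \<open>d \<ge> 2\<close> the trivial bound is used up to \<open>v = l\<^sup>2\<^sup>/\<^sup>d\<close>, the time the density bound needs to bring
  the mass of \<open>S\<close> below order one, and \<open>v\<^sup>-\<^sup>d\<^sup>/\<^sup>2 l\<close> afterwards. In each case the integral is of order
  \<open>l \<psi>\<^sub>d(l)\<^sup>2\<close> (\<open>short_time_potential_bound\<close>); this is the origin of the function \<open>\<psi>\<^sub>d\<close>.

  For lags \<open>v > 1\<close> the centring term matters: \<open>m\<^sup>2\<close> is the integral of \<open>f(x) f(y)\<close> against
  \<open>\<mu>(dx) \<rho>(y) dy\<close>, so the covariance is the integral of \<open>f(x) f(y) (p\<^sub>v(x,y) - \<rho>(y))\<close> against
  \<open>\<mu>(dx) dy\<close>, hence at most \<open>M\<^sup>2 r\<^sub>S(v) \<mu>(S) l\<close> (\<open>covariance_le_density_distance\<close>). These bounds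
  integrate to \<open>M\<^sup>2 \<mu>(S) l c\<^sub>S\<close>, and \<open>l \<le> l \<psi>\<^sub>d(l)\<^sup>2\<close> merges the two contributions.
\<close>

section \<open>Second moments of time integrals\<close>

lemma second_moment_of_integral:
  fixes Y :: "'i \<Rightarrow> 'w \<Rightarrow> real"
  assumes "finite_measure L" "finite_measure M"
    and Y [measurable]: "(\<lambda>(t, \<omega>). Y t \<omega>) \<in> borel_measurable (L \<Otimes>\<^sub>M M)"
    and bound: "\<And>t \<omega>. t \<in> space L \<Longrightarrow> \<omega> \<in> space M \<Longrightarrow> \<bar>Y t \<omega>\<bar> \<le> B"
  shows "(\<integral>\<omega>. (\<integral>t. Y t \<omega> \<partial>L)\<^sup>2 \<partial>M) = (\<integral>s. (\<integral>t. (\<integral>\<omega>. Y s \<omega> * Y t \<omega> \<partial>M) \<partial>L) \<partial>L)"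
proof -
  interpret L: finite_measure L by fact
  interpret M: finite_measure M by fact
  interpret LM: pair_sigma_finite L M ..
  have fin: "finite_measure (L \<Otimes>\<^sub>M M)"
    by (rule finite_measure_pair_measure) (fact assms)+
  interpret PM: finite_measure "L \<Otimes>\<^sub>M M" by (rule fin)
  define Z where "Z \<omega> = (\<integral>t. Y t \<omega> \<partial>L)" for \<omega>
  have [measurable]: "Z \<in> borel_measurable M"
    unfolding Z_def by measurable
  \<comment> \<open>Both exchanges of integrals below are instances of this one: \<open>g\<close> is first the whole integral
    \<open>Z\<close> and then a single \<open>Y s\<close>.\<close>
  have swap: "(\<integral>\<omega>. (\<integral>t. Y t \<omega> * g \<omega> \<partial>L) \<partial>M) = (\<integral>t. (\<integral>\<omega>. Y t \<omega> * g \<omega> \<partial>M) \<partial>L)"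
    if [measurable]: "g \<in> borel_measurable M" and g: "\<And>\<omega>. \<omega> \<in> space M \<Longrightarrow> \<bar>g \<omega>\<bar> \<le> K"
    for g K
  proof (rule LM.Fubini_integral)
    show "integrable (L \<Otimes>\<^sub>M M) (\<lambda>(t, \<omega>). Y t \<omega> * g \<omega>)"
    proof (rule PM.integrable_const_bound)
      show "AE x in L \<Otimes>\<^sub>M M. norm (case x of (t, \<omega>) \<Rightarrow> Y t \<omega> * g \<omega>) \<le> B * K"
      proof (rule AE_I2)
        fix x assume "x \<in> space (L \<Otimes>\<^sub>M M)"
        then have "\<bar>Y (fst x) (snd x)\<bar> * \<bar>g (snd x)\<bar> \<le> B * K"
          using bound[of "fst x" "snd x"] g[of "snd x"]
          by (intro mult_mono) (auto simp: space_pair_measure)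
        then show "norm (case x of (t, \<omega>) \<Rightarrow> Y t \<omega> * g \<omega>) \<le> B * K"
          by (simp add: case_prod_beta abs_mult)
      qed
    qed measurable
  qed
  have Z_bound: "\<bar>Z \<omega>\<bar> \<le> B * measure L (space L)" if "\<omega> \<in> space M" for \<omega>
  proof -
    have [measurable]: "(\<lambda>t. Y t \<omega>) \<in> borel_measurable L"
      using that by measurable
    have int: "integrable L (\<lambda>t. Y t \<omega>)"
      by (rule L.integrable_const_bound[where B = B]) (use bound that in auto)
    have "\<bar>Z \<omega>\<bar> \<le> (\<integral>t. \<bar>Y t \<omega>\<bar> \<partial>L)"
      unfolding Z_def by (rule integral_abs_bound)
    also have "\<dots> \<le> (\<integral>t. B \<partial>L)"
      using int bound that by (intro integral_mono) auto
    finally show ?thesis by (simp add: mult.commute)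
  qed
  have "(\<integral>\<omega>. (Z \<omega>)\<^sup>2 \<partial>M) = (\<integral>\<omega>. (\<integral>t. Y t \<omega> * Z \<omega> \<partial>L) \<partial>M)"
    unfolding power2_eq_square by (simp add: Z_def)
  also have "\<dots> = (\<integral>s. (\<integral>\<omega>. Y s \<omega> * Z \<omega> \<partial>M) \<partial>L)"
    by (rule swap[OF _ Z_bound]) auto
  also have "\<dots> = (\<integral>s. (\<integral>t. (\<integral>\<omega>. Y s \<omega> * Y t \<omega> \<partial>M) \<partial>L) \<partial>L)"
  proof (rule Bochner_Integration.integral_cong[OF refl])
    fix s assume s: "s \<in> space L"
    have [measurable]: "(\<lambda>\<omega>. Y s \<omega>) \<in> borel_measurable M"
      using s by measurable
    have "(\<integral>\<omega>. Y s \<omega> * Z \<omega> \<partial>M) = (\<integral>\<omega>. (\<integral>t. Y t \<omega> * Y s \<omega> \<partial>L) \<partial>M)"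
      by (simp add: Z_def mult.commute)
    also have "\<dots> = (\<integral>t. (\<integral>\<omega>. Y t \<omega> * Y s \<omega> \<partial>M) \<partial>L)"
      by (rule swap[OF _ bound[OF s]]) auto
    finally show "(\<integral>\<omega>. Y s \<omega> * Z \<omega> \<partial>M) = (\<integral>t. (\<integral>\<omega>. Y s \<omega> * Y t \<omega> \<partial>M) \<partial>L)"
      by (simp add: mult.commute)
  qed
  finally show ?thesis by (simp add: Z_def)
qed

text \<open>
  For fixed \<open>s\<close>, the lags \<open>\<bar>t - s\<bar>\<close> run over \<open>(0,\<infinity>)\<close> at most twice, once for \<open>t > s\<close> and once for
  \<open>t < s\<close>. The diagonal is a null set and is left out of the hypothesis because a density bound
  may blow up at lag zero.
\<close>

lemma integral_difference_kernel_le: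
  fixes c :: "real \<Rightarrow> real \<Rightarrow> real" and G :: "real \<Rightarrow> ennreal"
  assumes [measurable]: "G \<in> borel_measurable borel"
    and c: "\<And>s t. 0 \<le> s \<Longrightarrow> 0 \<le> t \<Longrightarrow> s \<noteq> t \<Longrightarrow> ennreal (c s t) \<le> G \<bar>t - s\<bar>"
    and K: "0 \<le> K" "(\<integral>\<^sup>+v\<in>{0<..}. G v \<partial>lborel) \<le> ennreal K"
    and T: "0 \<le> T"
  shows "(\<integral>s. (\<integral>t. c s t \<partial>restrict_space lborel {0..T}) \<partial>restrict_space lborel {0..T}) \<le> 2 * T * K"
proof -
  let ?L = "restrict_space lborel {0..T}"
  define g where "g v = G v * indicator {0<..} v" for v
  have [measurable]: "g \<in> borel_measurable borel"
    unfolding g_def by measurable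
  have inner: "(\<integral>t. c s t \<partial>?L) \<le> 2 * K" if s: "s \<in> {0..T}" for s
  proof (rule integral_real_bounded)
    have "(\<integral>\<^sup>+t. ennreal (c s t) \<partial>?L) = (\<integral>\<^sup>+t. ennreal (c s t) * indicator {0..T} t \<partial>lborel)"
      by (rule nn_integral_restrict_space) auto
    also have "\<dots> \<le> (\<integral>\<^sup>+t. g (- s + 1 * t) + g (s + (- 1) * t) \<partial>lborel)"
    proof (rule nn_integral_mono_AE)
      show "AE t in lborel. ennreal (c s t) * indicator {0..T} t \<le> g (- s + 1 * t) + g (s + (- 1) * t)"
        using AE_lborel_singleton[of s]
      proof eventually_elim
        case (elim t)
        show ?case
          using c[of s t] s elim
          by (cases "s < t") (auto simp: g_def indicator_def abs_if)
      qed
    qed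
    also have "\<dots> = (\<integral>\<^sup>+t. g (- s + 1 * t) \<partial>lborel) + (\<integral>\<^sup>+t. g (s + (- 1) * t) \<partial>lborel)"
      by (rule nn_integral_add) auto
    also have "\<dots> = (\<integral>\<^sup>+v. g v \<partial>lborel) + (\<integral>\<^sup>+v. g v \<partial>lborel)"
      using nn_integral_real_affine[of g 1 "- s"] nn_integral_real_affine[of g "- 1" s] by simp
    also have "\<dots> \<le> ennreal K + ennreal K"
      unfolding g_def by (intro add_mono K)
    finally show "(\<integral>\<^sup>+t. ennreal (c s t) \<partial>?L) \<le> ennreal (2 * K)"
      using K(1) by (simp add: ennreal_plus[symmetric] del: ennreal_plus)
  qed (use K in simp)
  show ?thesis
  proof (rule integral_real_bounded)
    have "(\<integral>\<^sup>+s. ennreal (\<integral>t. c s t \<partial>?L) \<partial>?L) \<le> (\<integral>\<^sup>+s. ennreal (2 * K) \<partial>?L)"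
      by (intro nn_integral_mono ennreal_leI inner) (simp add: space_restrict_space)
    also have "\<dots> = ennreal (2 * K) * ennreal T"
      using T by (simp add: emeasure_restrict_space space_restrict_space)
    finally show "(\<integral>\<^sup>+s. ennreal (\<integral>t. c s t \<partial>?L) \<partial>?L) \<le> ennreal (2 * T * K)"
      using T K by (simp add: ennreal_mult[symmetric] ac_simps)
  qed (use T K in simp)
qed

text \<open>
  Joint measurability, needed for every use of Fubini: a right-continuous path is the limit of its
  values at the smallest multiple of \<open>1 / (n + 1)\<close> strictly after \<open>t\<close>, and each such approximation
  takes countably many times. The truncation \<open>max 0 t\<close> is there because nothing is known about the
  process at negative times.
\<close>

lemma measurable_right_continuous_process:
  fixes Z :: "real \<Rightarrow> 'w \<Rightarrow> 'a::metric_space"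
  assumes meas: "\<And>t. 0 \<le> t \<Longrightarrow> Z t \<in> borel_measurable N"
    and right: "\<And>\<omega> t. \<omega> \<in> space N \<Longrightarrow> 0 \<le> t \<Longrightarrow> continuous (at_right t) (\<lambda>s. Z s \<omega>)"
  shows "(\<lambda>(t, \<omega>). Z (max 0 t) \<omega>) \<in> borel_measurable (borel \<Otimes>\<^sub>M N)"
proof -
  define a where "a n t = (of_int (\<lfloor>real (Suc n) * max 0 t\<rfloor> + 1) / real (Suc n) :: real)" for n t
  have a_gt: "max 0 t < a n t" and a_le: "a n t \<le> max 0 t + inverse (real (Suc n))" for n t
  proof -
    have "real (Suc n) * max 0 t < of_int (\<lfloor>real (Suc n) * max 0 t\<rfloor> + 1)"
      by linarith
    then show "max 0 t < a n t"
      unfolding a_def by (subst pos_less_divide_eq) (simp_all only: mult.commute of_nat_0_less_iff zero_less_Suc)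
    have "of_int (\<lfloor>real (Suc n) * max 0 t\<rfloor> + 1) \<le> real (Suc n) * max 0 t + 1"
      by linarith
    then have "a n t \<le> (real (Suc n) * max 0 t + 1) / real (Suc n)"
      unfolding a_def by (intro divide_right_mono) auto
    also have "\<dots> = max 0 t + inverse (real (Suc n))"
      by (simp add: add_divide_distrib inverse_eq_divide del: of_nat_Suc)
    finally show "a n t \<le> max 0 t + inverse (real (Suc n))" .
  qed
  have a_lim: "filterlim (\<lambda>n. a n t) (at_right (max 0 t)) sequentially" for t
  proof (rule tendsto_imp_filterlim_at_right)
    show "(\<lambda>n. a n t) \<longlonglongrightarrow> max 0 t"
    proof (rule real_tendsto_sandwich[where f = "\<lambda>_. max 0 t" and h = "\<lambda>n. max 0 t + inverse (real (Suc n))"])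
      show "(\<lambda>n. max 0 t + inverse (real (Suc n))) \<longlonglongrightarrow> max 0 t"
        using tendsto_add[OF tendsto_const LIMSEQ_inverse_real_of_nat, of "max 0 t"] by simp
    qed (use less_imp_le[OF a_gt] a_le in auto)
  qed (use a_gt in simp)
  show ?thesis
  proof (rule borel_measurable_LIMSEQ_metric)
    fix n
    have step: "(\<lambda>x. Z (max 0 (of_int k / real (Suc n))) (snd x)) \<in> borel_measurable (borel \<Otimes>\<^sub>M N)" for k :: int
      by (rule measurable_compose[OF measurable_snd meas]) simp
    have "(\<lambda>x. Z (max 0 (of_int (\<lfloor>real (Suc n) * max 0 (fst x)\<rfloor> + 1) / real (Suc n))) (snd x))
        \<in> borel_measurable (borel \<Otimes>\<^sub>M N)"
      by (rule measurable_compose_countable[OF step]) measurable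
    moreover have "max 0 (of_int (\<lfloor>real (Suc n) * max 0 t\<rfloor> + 1) / real (Suc n)) = a n t" for t
      using a_gt[of t n] unfolding a_def by linarith
    ultimately show "(\<lambda>x. Z (a n (fst x)) (snd x)) \<in> borel_measurable (borel \<Otimes>\<^sub>M N)"
      by simp
  next
    fix x :: "real \<times> 'w" assume "x \<in> space (borel \<Otimes>\<^sub>M N)"
    then have "continuous (at_right (max 0 (fst x))) (\<lambda>s. Z s (snd x))"
      by (intro right) (auto simp: space_pair_measure)
    then have "((\<lambda>s. Z s (snd x)) \<longlongrightarrow> Z (max 0 (fst x)) (snd x)) (at_right (max 0 (fst x)))"
      by (simp add: continuous_within)
    from filterlim_compose[OF this a_lim]
    show "(\<lambda>n. Z (a n (fst x)) (snd x)) \<longlonglongrightarrow> (case x of (t, \<omega>) \<Rightarrow> Z (max 0 t) \<omega>)"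
      by (simp add: case_prod_beta)
  qed
qed

section \<open>Occupation of small sets over short times\<close>

lemma powr_integral_le:
  fixes q D :: real
  assumes "1 < q" "0 < D" "D \<le> 1"
  shows "(\<integral>\<^sup>+v\<in>{D..1}. ennreal (v powr - q) \<partial>lborel) \<le> ennreal (D powr (1 - q) / (q - 1))"
proof -
  have "(\<integral>\<^sup>+v\<in>{D..1}. ennreal (v powr - q) \<partial>lborel) = ennreal (1 powr (1 - q) / (1 - q) - D powr (1 - q) / (1 - q))"
  proof (rule nn_integral_FTC_Icc[where F = "\<lambda>v. v powr (1 - q) / (1 - q)"])
    fix v assume "v \<in> {D..1}"
    then show "((\<lambda>v. v powr (1 - q) / (1 - q)) has_real_derivative v powr - q) (at v)"
      using assms by (auto intro!: derivative_eq_intros)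
  qed (use assms in auto)
  also have "\<dots> \<le> ennreal (D powr (1 - q) / (q - 1))"
    using assms by (intro ennreal_leI) (simp add: field_simps)
  finally show ?thesis .
qed

lemma inverse_integral:
  fixes D :: real
  assumes "0 < D" "D \<le> 1"
  shows "(\<integral>\<^sup>+v\<in>{D..1}. ennreal (v powr - 1) \<partial>lborel) = ennreal (ln (1 / D))"
proof -
  have "(\<integral>\<^sup>+v\<in>{D..1}. ennreal (v powr - 1) \<partial>lborel) = ennreal (ln 1 - ln D)"
  proof (rule nn_integral_FTC_Icc[where F = ln])
    fix v assume "v \<in> {D..1}"
    then show "(ln has_real_derivative v powr - 1) (at v)"
      using assms by (auto intro!: derivative_eq_intros simp: powr_minus field_simps)
  qed (use assms in auto)
  then show ?thesis using assms by (simp add: ln_div)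
qed

text \<open>
  The cut-off at \<open>D\<close> removes the singularity at zero, where \<open>v powr - q\<close> is not integrable for
  \<open>q \<ge> 1\<close>.
\<close>

lemma truncated_powr_integral_le:
  fixes q c l D J :: real
  assumes "0 \<le> D" "0 \<le> c" "0 \<le> l" "0 \<le> J"
    and J: "(\<integral>\<^sup>+v\<in>{D..1}. ennreal (v powr - q) \<partial>lborel) \<le> ennreal J"
  shows "(\<integral>\<^sup>+v\<in>{0<..1}. ennreal (if v \<le> D then 1 else c * v powr - q * l) \<partial>lborel)
    \<le> ennreal (D + c * l * J)"
proof -
  have "(\<integral>\<^sup>+v\<in>{0<..1}. ennreal (if v \<le> D then 1 else c * v powr - q * l) \<partial>lborel)
    \<le> (\<integral>\<^sup>+v. indicator {0..D} v + ennreal (c * l) * (ennreal (v powr - q) * indicator {D..1} v) \<partial>lborel)"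
    using assms by (intro nn_integral_mono)
      (auto simp: indicator_def ennreal_mult[symmetric] ac_simps)
  also have "\<dots> = ennreal D + ennreal (c * l) * (\<integral>\<^sup>+v\<in>{D..1}. ennreal (v powr - q) \<partial>lborel)"
    using assms by (simp add: nn_integral_add nn_integral_cmult)
  also have "\<dots> \<le> ennreal D + ennreal (c * l) * ennreal J"
    by (intro add_left_mono mult_left_mono J) auto
  also have "\<dots> = ennreal (D + c * l * J)"
    using assms by (simp add: ennreal_mult ennreal_plus)
  finally show ?thesis .
qed

lemma le_times_psi_squared:
  assumes "0 \<le> l" "l < 1"
  shows "l \<le> l * (psi d l)\<^sup>2"
proof (cases "l = 0")
  case False
  then have l: "0 < l" using assms by simp
  have "1 \<le> (psi d l)\<^sup>2"
  proof -
    consider "d = 1" | "d = 2" | "d = 0" | "d \<ge> 3" by linarith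
    then show ?thesis
    proof cases
      case 2
      have "0 \<le> ln (1 / l)" using l assms by (simp add: ln_div)
      with 2 show ?thesis by (simp add: psi_def)
    next
      case 3
      have "1 \<le> l powr (- 1 / 2)" using powr_mono'[of "-1/2" 0 l] l assms by simp
      with 3 show ?thesis by (simp add: psi_def)
    next
      case 4
      have "1 / real d - 1 / 2 \<le> 0" using 4 by (simp add: field_simps)
      then have "1 \<le> l powr (1 / real d - 1 / 2)" using powr_mono'[of "1 / real d - 1 / 2" 0 l] l assms by simp
      with 4 show ?thesis by (simp add: psi_def)
    qed (simp add: psi_def)
  qed
  with l show ?thesis by simp
qed simp

text \<open>
  The function \<open>h\<close> dominates \<open>P\<^sub>v(x, S)\<close> uniformly in \<open>x\<close> whenever \<open>S\<close> has Lebesgue measure \<open>l\<close>, and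
  its integral bounds the expected time spent in \<open>S\<close> before time one. The disjunction says which of
  the two bounds of \<open>P\<^sub>v(x, S)\<close> is in force: total mass one, or volume times the supremum of the
  density. In dimension \<open>d \<ge> 2\<close> the first contributes the cut-off \<open>D\<close> to the
  integral, and the second the integral of \<open>c v\<^sup>-\<^sup>q l\<close> over \<open>[D,1]\<close>, where \<open>q = d / 2\<close>. For \<open>l > 0\<close> the
  cut-off is \<open>l\<^sup>1\<^sup>/\<^sup>q\<close>, the time at which \<open>v\<^sup>-\<^sup>q l\<close> falls to one.
\<close>

lemma short_time_potential_bound:
  fixes p :: "real \<Rightarrow> 'a::euclidean_space \<Rightarrow> 'a \<Rightarrow> real"
  assumes "short_time_density_bound p"
  obtains A where "0 \<le> A"
    "\<And>l. 0 \<le> l \<Longrightarrow> l < 1 \<Longrightarrow> \<exists>h. h \<in> borel_measurable borel \<and> (\<forall>v. 0 \<le> h v) \<and>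
      (\<forall>v\<in>{0<..1}. 1 \<le> h v \<or> (\<exists>K\<ge>0. K * l \<le> h v \<and> (\<forall>x y. p v x y \<le> K))) \<and>
      (\<integral>\<^sup>+v\<in>{0<..1}. ennreal (h v) \<partial>lborel) \<le> ennreal (A * (l * (psi DIM('a) l)\<^sup>2))"
proof -
  consider "DIM('a) = 1" | "DIM('a) \<ge> 2"
    using DIM_positive[where 'a = 'a] by linarith
  then show thesis
  proof cases
    case 1
    then obtain \<alpha> :: "real \<Rightarrow> real" where a: "set_borel_measurable borel {0<..1} \<alpha>" "\<forall>t\<in>{0<..1}. 0 \<le> \<alpha> t"
      "\<forall>t\<in>{0<..1}. \<forall>x y. p t x y \<le> \<alpha> t" "set_integrable lborel {0<..1} \<alpha>"
      using assms unfolding short_time_density_bound_def by blast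
    define b where "b v = indicator {0<..1} v * \<alpha> v" for v
    have b: "b \<in> borel_measurable borel" "integrable lborel b" "\<And>v. 0 \<le> b v"
      using a unfolding b_def[abs_def] set_borel_measurable_def set_integrable_def
      by (auto simp: indicator_def simp flip: real_scaleR_def)
    note [measurable] = b(1)
    define A where "A = (\<integral>v. b v \<partial>lborel)"
    have A: "0 \<le> A" unfolding A_def using b by simp
    show thesis
    proof (rule that[OF A], intro exI conjI allI ballI)
      fix l :: real assume l: "0 \<le> l" "l < 1"
      show "(\<lambda>v. b v * l) \<in> borel_measurable borel" by measurable
      show "0 \<le> b v * l" for v using b l by simp
      show "1 \<le> b v * l \<or> (\<exists>K\<ge>0. K * l \<le> b v * l \<and> (\<forall>x y. p v x y \<le> K))" if "v \<in> {0<..1}" for v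
        using a(2,3) that by (intro disjI2 exI[of _ "\<alpha> v"]) (simp add: b_def)
      have "(\<integral>\<^sup>+v\<in>{0<..1}. ennreal (b v * l) \<partial>lborel) = (\<integral>\<^sup>+v. ennreal (b v * l) \<partial>lborel)"
        by (intro nn_integral_cong) (auto simp: b_def indicator_def)
      also have "\<dots> = ennreal (A * l)"
        using b l by (subst nn_integral_eq_integral) (auto simp: A_def)
      finally show "(\<integral>\<^sup>+v\<in>{0<..1}. ennreal (b v * l) \<partial>lborel) \<le> ennreal (A * (l * (psi DIM('a) l)\<^sup>2))"
        using 1 by (simp add: psi_def)
    qed
  next
    case 2
    define q where "q = real DIM('a) / 2"
    obtain c where c: "c > 0" "\<forall>t\<in>{0<..1}. \<forall>x y. p t x y \<le> c * t powr - q"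
      using assms 2 unfolding short_time_density_bound_def q_def by auto
    have h: "(\<lambda>v. if v \<le> D then 1 else c * v powr - q * l) \<in> borel_measurable borel"
        "0 \<le> (if v \<le> D then 1 else c * v powr - q * l)"
        "v \<in> {0<..1} \<Longrightarrow> 1 \<le> (if v \<le> D then 1 else c * v powr - q * l) \<or>
          (\<exists>K\<ge>0. K * l \<le> (if v \<le> D then 1 else c * v powr - q * l) \<and> (\<forall>x y. p v x y \<le> K))"
      if "0 \<le> l" for D l v :: real
      using c that by (auto intro!: exI[of _ "c * v powr - q"])
    (* The factor 2 bounds 1 / (q - 1) for all dimensions from three on. *)
    have A: "0 \<le> 1 + 2 * c" using c by simp
    show thesis
    proof (rule that[OF A])
      fix l :: real assume l: "0 \<le> l" "l < 1"
      have main: "\<exists>D. (\<integral>\<^sup>+v\<in>{0<..1}. ennreal (if v \<le> D then 1 else c * v powr - q * l) \<partial>lborel)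
          \<le> ennreal ((1 + 2 * c) * (l * (psi DIM('a) l)\<^sup>2))"
      proof -
        consider "l = 0" | "0 < l" "DIM('a) = 2" | "0 < l" "DIM('a) \<ge> 3"
          using l 2 by linarith
        then show ?thesis
        proof cases
          case 1
          (* A null set needs no cut-off: h vanishes at all positive times. *)
          have "(\<integral>\<^sup>+v\<in>{0<..1}. ennreal (if v \<le> 0 then 1 else c * v powr - q * l) \<partial>lborel) = (\<integral>\<^sup>+v. 0 \<partial>(lborel :: real measure))"
            by (intro nn_integral_cong) (auto simp: indicator_def 1)
          then show ?thesis by (intro exI[of _ 0]) simp
        next
          case 2
          have ln: "0 \<le> ln (1 / l)" using 2 l by (simp add: ln_div)
          have "(\<integral>\<^sup>+v\<in>{0<..1}. ennreal (if v \<le> l then 1 else c * v powr - q * l) \<partial>lborel)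
              \<le> ennreal (l + c * l * ln (1 / l))"
            using inverse_integral[of l] 2 l c ln
            by (intro truncated_powr_integral_le) (auto simp: q_def)
          also have "\<dots> \<le> ennreal ((1 + 2 * c) * (l * (psi DIM('a) l)\<^sup>2))"
          proof (rule ennreal_leI)
            have "0 \<le> c * l" "0 \<le> l * ln (1 / l)" "0 \<le> c * l * ln (1 / l)" using 2 c ln by auto
            then show "l + c * l * ln (1 / l) \<le> (1 + 2 * c) * (l * (psi DIM('a) l)\<^sup>2)"
              using 2 ln by (simp add: psi_def algebra_simps)
          qed
          finally show ?thesis by blast
        next
          case 3
          define D where "D = l powr (1 / q)"
          have q: "3 / 2 \<le> q" using 3 by (simp add: q_def)
          have D: "0 < D" "D \<le> 1" using 3 l q by (auto simp: D_def powr_le1)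
          have psi: "l * (psi DIM('a) l)\<^sup>2 = D"
          proof -
            have "(psi DIM('a) l)\<^sup>2 = l powr (1 / q - 1)"
              using 3 by (simp add: psi_def q_def power2_eq_square powr_add[symmetric])
            then show ?thesis using 3 powr_mult_base[of l "1 / q - 1"] by (simp add: D_def)
          qed
          (* The balance: both parts of the integral are of order D. *)
          have lD: "l * D powr (1 - q) = D"
          proof -
            have "D powr q = l" using 3 q by (simp add: D_def powr_powr)
            then show ?thesis using D 3 by (simp add: powr_diff)
          qed
          have "(\<integral>\<^sup>+v\<in>{0<..1}. ennreal (if v \<le> D then 1 else c * v powr - q * l) \<partial>lborel)
              \<le> ennreal (D + c * l * (D powr (1 - q) / (q - 1)))"
            using powr_integral_le[of q D] D l c q
            by (intro truncated_powr_integral_le) auto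
          also have "\<dots> \<le> ennreal ((1 + 2 * c) * (l * (psi DIM('a) l)\<^sup>2))"
          proof (rule ennreal_leI)
            have "c * l * (D powr (1 - q) / (q - 1)) = c * (l * D powr (1 - q)) / (q - 1)"
              by simp
            also have "\<dots> = c * D / (q - 1)"
              by (simp only: lD)
            also have "\<dots> \<le> c * D / (1 / 2)"
              using c D q by (intro divide_left_mono) auto
            finally show "D + c * l * (D powr (1 - q) / (q - 1)) \<le> (1 + 2 * c) * (l * (psi DIM('a) l)\<^sup>2)"
              unfolding psi by (simp add: algebra_simps)
          qed
          finally show ?thesis by blast
        qed
      qed
      then show "\<exists>h. h \<in> borel_measurable borel \<and> (\<forall>v. 0 \<le> h v) \<and>
        (\<forall>v\<in>{0<..1}. 1 \<le> h v \<or> (\<exists>K\<ge>0. K * l \<le> h v \<and> (\<forall>x y. p v x y \<le> K))) \<and>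
        (\<integral>\<^sup>+v\<in>{0<..1}. ennreal (h v) \<partial>lborel) \<le> ennreal ((1 + 2 * c) * (l * (psi DIM('a) l)\<^sup>2))"
        using h[OF l(1)] by (elim exE) (rule exI, intro conjI allI ballI, assumption+)
    qed
  qed
qed

section \<open>One- and two-time laws of the stationary process\<close>

lemma space_observed [simp]: "space (observed W X I) = W"
  unfolding observed_def by (simp add: space_measure_of_conv)

lemma sets_observed:
  "sets (observed W X I) = sigma_sets W {X s -` B \<inter> W | s B. s \<in> I \<and> B \<in> sets borel}"
  unfolding observed_def by (intro sets_measure_of) auto

lemma measurable_observed:
  assumes "s \<in> I"
  shows "X s \<in> observed W X I \<rightarrow>\<^sub>M borel"
proof (rule measurableI)
  fix B :: "'b set" assume "B \<in> sets borel"
  then show "X s -` B \<inter> space (observed W X I) \<in> sets (observed W X I)"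
    unfolding sets_observed space_observed using assms by (intro sigma_sets.Basic) auto
qed simp

lemma sets_observed_mono: "I \<subseteq> J \<Longrightarrow> sets (observed W X I) \<subseteq> sets (observed W X J)"
  unfolding sets_observed by (intro sigma_sets_mono') auto

context borel_right_process
begin

lemma prob_space_law [simp, intro]: "prob_space (P x)"
  and sets_law [measurable_cong]: "sets (P x) = sets (observed W X {0..})"
  using measurable_space[OF laws, of x] by (auto simp: space_prob_algebra)

lemma space_law [simp]: "space (P x) = W"
  using sets_eq_imp_space_eq[OF sets_law] by simp

lemma law_subprob: "P \<in> borel \<rightarrow>\<^sub>M subprob_algebra (observed W X {0..})"
  by (rule measurable_prob_algebraD[OF laws])

lemma measurable_position: "0 \<le> s \<Longrightarrow> X s \<in> observed W X {0..} \<rightarrow>\<^sub>M borel"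
  by (rule measurable_observed) simp

lemma prob_space_transition: "0 \<le> t \<Longrightarrow> prob_space (transition X P t x)"
  unfolding transition_def
  by (intro prob_space.prob_space_distr prob_space_law)
     (auto intro: measurable_position simp: measurable_cong_sets[OF sets_law refl])

lemma emeasure_transition:
  "0 \<le> t \<Longrightarrow> B \<in> sets borel \<Longrightarrow> emeasure (transition X P t x) B = emeasure (P x) (X t -` B \<inter> W)"
  unfolding transition_def
  by (subst emeasure_distr) (auto intro: measurable_position simp: measurable_cong_sets[OF sets_law refl])

lemma measurable_emeasure_transition:
  assumes "0 \<le> t" "B \<in> sets borel"
  shows "(\<lambda>x. emeasure (transition X P t x) B) \<in> borel_measurable borel"
proof -
  have "X t -` B \<inter> W \<in> sets (observed W X {0..})"
    using measurable_sets[OF measurable_position assms(2)] assms(1) by simp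
  from measurable_emeasure_kernel[OF law_subprob this] show ?thesis
    by (simp add: emeasure_transition assms)
qed

text \<open>
  The Markov property determines the conditional probability of \<open>X (s + t) \<in> B\<close>; integrating it
  against the event \<open>X s \<in> A\<close>, which is known at time \<open>s\<close>, gives the joint probability.
\<close>

lemma law_two_times:
  assumes s: "0 \<le> s" and t: "0 \<le> t" and A [measurable]: "A \<in> sets borel" and B [measurable]: "B \<in> sets borel"
  shows "emeasure (P x) {\<omega>\<in>W. X s \<omega> \<in> A \<and> X (s + t) \<omega> \<in> B} =
    (\<integral>\<^sup>+\<omega>. indicator A (X s \<omega>) * emeasure (transition X P t (X s \<omega>)) B \<partial>P x)"
proof -
  let ?F = "observed W X {0..s}"
  let ?k = "\<lambda>y. measure (transition X P t y) B"
  interpret prob_space "P x" by simp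
  interpret finite_measure_subalgebra "P x" ?F
    by standard (use sets_observed_mono[of "{0..s}" "{0..}" W X] in \<open>auto simp: subalgebra_def sets_law\<close>)
  have [measurable]: "X s \<in> P x \<rightarrow>\<^sub>M borel" "X (s + t) \<in> P x \<rightarrow>\<^sub>M borel"
    using s t by (auto intro: measurable_position simp: measurable_cong_sets[OF sets_law refl])
  have XF [measurable]: "X s \<in> ?F \<rightarrow>\<^sub>M borel"
    using s by (intro measurable_observed) simp
  have [measurable]: "?k \<in> borel_measurable borel"
    unfolding measure_def using measurable_emeasure_transition[OF t B] by measurable
  have k_le: "?k y \<le> 1" for y
    using prob_space.prob_le_1[OF prob_space_transition[OF t]] by simp
  have "measure (P x) {\<omega>\<in>W. X s \<omega> \<in> A \<and> X (s + t) \<omega> \<in> B} =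
      (\<integral>\<omega>. indicator {\<omega>\<in>W. X s \<omega> \<in> A \<and> X (s + t) \<omega> \<in> B} \<omega> \<partial>P x)"
    by simp (rule arg_cong[where f = prob], auto)
  also have "\<dots> = (\<integral>\<omega>. indicator A (X s \<omega>) * indicator B (X (s + t) \<omega>) \<partial>P x)"
    by (intro Bochner_Integration.integral_cong) (auto simp: indicator_def)
  also have "\<dots> = (\<integral>\<omega>. indicator A (X s \<omega>) * real_cond_exp (P x) ?F (\<lambda>\<omega>. indicator B (X (s + t) \<omega>)) \<omega> \<partial>P x)"
  proof (rule real_cond_exp_intg(2)[symmetric])
    show "integrable (P x) (\<lambda>\<omega>. indicator A (X s \<omega>) * indicator B (X (s + t) \<omega>) :: real)"
      by (rule integrable_const_bound[where B = 1]) (auto simp: indicator_def)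
  qed measurable
  also have "\<dots> = (\<integral>\<omega>. indicator A (X s \<omega>) * ?k (X s \<omega>) \<partial>P x)"
    using markov[OF s t B, of x] by (intro integral_cong_AE) auto
  finally have "emeasure (P x) {\<omega>\<in>W. X s \<omega> \<in> A \<and> X (s + t) \<omega> \<in> B} =
      ennreal (\<integral>\<omega>. indicator A (X s \<omega>) * ?k (X s \<omega>) \<partial>P x)"
    by (simp add: emeasure_eq_measure)
  also have "\<dots> = (\<integral>\<^sup>+\<omega>. ennreal (indicator A (X s \<omega>) * ?k (X s \<omega>)) \<partial>P x)"
    using k_le
    by (intro nn_integral_eq_integral[symmetric] integrable_const_bound[where B = 1])
       (auto simp: indicator_def)
  also have "\<dots> = (\<integral>\<^sup>+\<omega>. indicator A (X s \<omega>) * emeasure (transition X P t (X s \<omega>)) B \<partial>P x)"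
    using finite_measure.emeasure_eq_measure[OF prob_space.finite_measure[OF prob_space_transition[OF t]]]
    by (intro nn_integral_cong) (auto simp: indicator_def)
  finally show ?thesis .
qed

end

locale stationary_right_process = borel_right_process W X P
  for W :: "'w set" and X :: "real \<Rightarrow> 'w \<Rightarrow> 'a::euclidean_space" and P +
  fixes \<mu> :: "'a measure"
  assumes invariant: "invariant_law (transition X P) \<mu>"
begin

sublocale initial: prob_space \<mu>
  using invariant by (simp add: invariant_law_def)

lemma sets_initial [measurable_cong, simp]: "sets \<mu> = sets borel"
  using invariant by (simp add: invariant_law_def)

lemma space_initial [simp]: "space \<mu> = UNIV"
  using sets_eq_imp_space_eq[OF sets_initial] by simp

abbreviation path_law :: "'w measure" where "path_law \<equiv> \<mu> \<bind> P"

lemma law_initial: "P \<in> \<mu> \<rightarrow>\<^sub>M prob_algebra (observed W X {0..})"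
    "P \<in> \<mu> \<rightarrow>\<^sub>M subprob_algebra (observed W X {0..})"
  using laws law_subprob by (auto simp: measurable_cong_sets[OF sets_initial refl])

lemma initial_in: "\<mu> \<in> space (prob_algebra \<mu>)"
  by (simp add: space_prob_algebra initial.prob_space_axioms)

sublocale path: prob_space path_law
  by (rule prob_space_bind'[OF initial_in law_initial(1)])

lemma sets_path_law [measurable_cong]: "sets path_law = sets (observed W X {0..})"
  by (rule sets_bind'[OF initial_in law_initial(1)])

lemma space_path_law [simp]: "space path_law = W"
  using sets_eq_imp_space_eq[OF sets_path_law] by simp

lemma measurable_path_position: "0 \<le> s \<Longrightarrow> X s \<in> path_law \<rightarrow>\<^sub>M borel"
  using measurable_position by (simp add: measurable_cong_sets[OF sets_path_law refl])

lemma stationary: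
  assumes s: "0 \<le> s"
  shows "distr path_law borel (X s) = \<mu>"
proof (rule measure_eqI)
  fix A assume "A \<in> sets (distr path_law borel (X s))"
  then have A [measurable]: "A \<in> sets borel" by simp
  have meas: "X s -` A \<inter> W \<in> sets (observed W X {0..})"
    using measurable_sets[OF measurable_position[OF s] A] by simp
  have "emeasure (distr path_law borel (X s)) A = emeasure path_law (X s -` A \<inter> W)"
    by (subst emeasure_distr[OF measurable_path_position[OF s] A]) simp
  also have "\<dots> = (\<integral>\<^sup>+x. emeasure (P x) (X s -` A \<inter> W) \<partial>\<mu>)"
    by (rule emeasure_bind[OF _ law_initial(2) meas]) simp
  also have "\<dots> = (\<integral>\<^sup>+x. emeasure (transition X P s x) A \<partial>\<mu>)"
    by (simp add: emeasure_transition[OF s A])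
  also have "\<dots> = emeasure \<mu> A"
    using invariant s A by (simp add: invariant_law_def)
  finally show "emeasure (distr path_law borel (X s)) A = emeasure \<mu> A" .
qed simp

lemma path_two_times:
  assumes s: "0 \<le> s" and t: "0 \<le> t" and A [measurable]: "A \<in> sets borel" and B [measurable]: "B \<in> sets borel"
  shows "emeasure path_law {\<omega>\<in>W. X s \<omega> \<in> A \<and> X (s + t) \<omega> \<in> B} =
    (\<integral>\<^sup>+x\<in>A. emeasure (transition X P t x) B \<partial>\<mu>)"
proof -
  have [measurable]: "X s \<in> observed W X {0..} \<rightarrow>\<^sub>M borel" "X (s + t) \<in> observed W X {0..} \<rightarrow>\<^sub>M borel"
    using s t by (auto intro: measurable_position)
  have [measurable]: "X s \<in> path_law \<rightarrow>\<^sub>M borel"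
    by (rule measurable_path_position[OF s])
  note [measurable] = measurable_emeasure_transition[OF t B]
  have "{\<omega>\<in>space (observed W X {0..}). X s \<omega> \<in> A \<and> X (s + t) \<omega> \<in> B} \<in> sets (observed W X {0..})"
    by measurable
  then have "emeasure path_law {\<omega>\<in>W. X s \<omega> \<in> A \<and> X (s + t) \<omega> \<in> B} =
      (\<integral>\<^sup>+x. emeasure (P x) {\<omega>\<in>W. X s \<omega> \<in> A \<and> X (s + t) \<omega> \<in> B} \<partial>\<mu>)"
    by (intro emeasure_bind[OF _ law_initial(2)]) simp_all
  also have "\<dots> = (\<integral>\<^sup>+x. \<integral>\<^sup>+\<omega>. indicator A (X s \<omega>) * emeasure (transition X P t (X s \<omega>)) B \<partial>P x \<partial>\<mu>)"
    by (simp add: law_two_times[OF s t A B])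
  also have "\<dots> = (\<integral>\<^sup>+\<omega>. indicator A (X s \<omega>) * emeasure (transition X P t (X s \<omega>)) B \<partial>path_law)"
    by (rule nn_integral_bind[OF _ law_initial(2), symmetric]) measurable
  also have "\<dots> = (\<integral>\<^sup>+x. indicator A x * emeasure (transition X P t x) B \<partial>distr path_law borel (X s))"
    by (rule nn_integral_distr[symmetric]) measurable
  finally show ?thesis
    by (simp add: stationary[OF s] mult.commute)
qed

text \<open>
  Stationarity and the Markov property give the mass of every rectangle, and rectangles determine a
  finite measure on the product.
\<close>

lemma pair_law:
  assumes s: "0 \<le> s" and v: "0 < v" and dens: "transition_density (transition X P) p"
  shows "distr path_law (borel \<Otimes>\<^sub>M borel) (\<lambda>\<omega>. (X s \<omega>, X (s + v) \<omega>)) =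
    density (\<mu> \<Otimes>\<^sub>M lborel) (\<lambda>(x, y). ennreal (p v x y))" (is "?D = ?Q")
proof -
  let ?E = "{a \<times> b | a b. a \<in> sets \<mu> \<and> b \<in> sets (lborel :: 'a measure)}"
  have [measurable]: "X s \<in> path_law \<rightarrow>\<^sub>M borel" "X (s + v) \<in> path_law \<rightarrow>\<^sub>M borel"
    using s v by (auto intro: measurable_path_position)
  have p [measurable]: "(\<lambda>(x, y). p v x y) \<in> borel_measurable (borel \<Otimes>\<^sub>M borel)"
    using dens v by (simp add: transition_density_def)
  have S: "sets (\<mu> \<Otimes>\<^sub>M lborel) = sets (borel \<Otimes>\<^sub>M (borel :: 'a measure))"
    by (intro sets_pair_measure_cong) auto
  interpret D: prob_space ?D
    by (rule path.prob_space_distr) measurable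
  show ?thesis
  proof (rule measure_eqI_generator_eq[OF Int_stable_pair_measure_generator[of \<mu> lborel], where \<Omega> = UNIV and A = "\<lambda>_. UNIV"])
    show "sets ?D = sigma_sets UNIV ?E" "sets ?Q = sigma_sets UNIV ?E"
      using S by (simp_all add: sets_pair_measure space_pair_measure)
    fix R assume "R \<in> ?E"
    then obtain A B where R: "R = A \<times> B" and A [measurable]: "A \<in> sets borel" and B [measurable]: "B \<in> sets borel"
      by auto
    have "emeasure ?D R = emeasure path_law {\<omega>\<in>W. X s \<omega> \<in> A \<and> X (s + v) \<omega> \<in> B}"
      unfolding R by (subst emeasure_distr) (auto intro!: arg_cong[where f = "emeasure path_law"])
    also have "\<dots> = (\<integral>\<^sup>+x\<in>A. emeasure (transition X P v x) B \<partial>\<mu>)"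
      using s v by (intro path_two_times) auto
    also have "\<dots> = (\<integral>\<^sup>+x. (\<integral>\<^sup>+y. ennreal (p v x y) * indicator (A \<times> B) (x, y) \<partial>lborel) \<partial>\<mu>)"
      using dens v
      by (intro nn_integral_cong) (auto simp: transition_density_def indicator_def intro!: nn_integral_cong)
    also have "\<dots> = (\<integral>\<^sup>+z. ennreal (p v (fst z) (snd z)) * indicator (A \<times> B) z \<partial>(\<mu> \<Otimes>\<^sub>M lborel))"
      by (subst lborel.nn_integral_fst[symmetric]) (auto simp: case_prod_beta)
    also have "\<dots> = emeasure ?Q R"
      unfolding R by (subst emeasure_density) (auto simp: case_prod_beta S)
    finally show "emeasure ?D R = emeasure ?Q R" .
  next
    show "range (\<lambda>_::nat. UNIV) \<subseteq> ?E"
      by (auto simp: intro!: exI[of _ UNIV])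
    show "emeasure ?D UNIV \<noteq> \<infinity>" by simp
  qed auto
qed

end

section \<open>Variance and covariances of the stationary process\<close>

context stationary_right_process
begin

lemma measurable_path_integrand:
  fixes f :: "'a \<Rightarrow> real"
  assumes [measurable]: "f \<in> borel_measurable borel"
  shows "(\<lambda>(t, \<omega>). f (X t \<omega>)) \<in> borel_measurable (restrict_space lborel {0..T} \<Otimes>\<^sub>M path_law)"
proof -
  let ?L = "restrict_space lborel {0..T}"
  have [measurable]: "(\<lambda>(t, \<omega>). X (max 0 t) \<omega>) \<in> borel_measurable (borel \<Otimes>\<^sub>M path_law)"
    by (rule measurable_right_continuous_process) (auto intro: measurable_path_position right_continuous)
  have [measurable]: "(\<lambda>t. t) \<in> ?L \<rightarrow>\<^sub>M borel"
    by (rule measurable_restrict_space1) simp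
  have "(\<lambda>z. f ((\<lambda>(t, \<omega>). X (max 0 t) \<omega>) (fst z, snd z))) \<in> borel_measurable (?L \<Otimes>\<^sub>M path_law)"
    by measurable
  then show ?thesis
    by (rule measurable_cong[THEN iffD1, rotated])
       (auto simp: space_pair_measure space_restrict_space max_def)
qed

lemma expectation_position:
  fixes f :: "'a \<Rightarrow> real"
  assumes "0 \<le> s" "f \<in> borel_measurable borel"
  shows "(\<integral>\<omega>. f (X s \<omega>) \<partial>path_law) = (\<integral>x. f x \<partial>\<mu>)"
  using integral_distr[OF measurable_path_position[OF assms(1)] assms(2)] stationary[OF assms(1)] by simp

lemma variance_time_integral:
  fixes f :: "'a \<Rightarrow> real" and T M :: real
  defines "L \<equiv> restrict_space lborel {0..T}" and "m \<equiv> (\<integral>x. f x \<partial>\<mu>)"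
  assumes f [measurable]: "f \<in> borel_measurable borel" and M: "\<And>x. \<bar>f x\<bar> \<le> M" and T: "0 \<le> T"
  shows "path.variance (\<lambda>\<omega>. LINT t:{0..T}|lborel. f (X t \<omega>)) =
    (\<integral>s. (\<integral>t. path.expectation (\<lambda>\<omega>. (f (X s \<omega>) - m) * (f (X t \<omega>) - m)) \<partial>L) \<partial>L)"
proof -
  have space_L: "space L = {0..T}" by (simp add: L_def space_restrict_space)
  have emeasure_L: "emeasure L (space L) = ennreal T"
    using T by (simp add: L_def emeasure_restrict_space space_restrict_space)
  interpret L: finite_measure L
    by standard (simp add: emeasure_L)
  have measure_L: "measure L (space L) = T"
    using T by (simp add: measure_def emeasure_L)
  interpret LM: pair_sigma_finite L path_law ..
  interpret PM: finite_measure "L \<Otimes>\<^sub>M path_law"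
    by (intro finite_measure_pair_measure L.finite_measure_axioms path.finite_measure_axioms)
  have meas [measurable]: "(\<lambda>(t, \<omega>). f (X t \<omega>)) \<in> borel_measurable (L \<Otimes>\<^sub>M path_law)"
    unfolding L_def by (rule measurable_path_integrand[OF f])
  have int: "integrable L (\<lambda>t. f (X t \<omega>))" if "\<omega> \<in> W" for \<omega>
  proof (rule L.integrable_const_bound[where B = M])
    have "(\<lambda>t. (\<lambda>(t, \<omega>). f (X t \<omega>)) (t, \<omega>)) \<in> borel_measurable L"
      using that by (intro measurable_compose[OF _ meas]) simp
    then show "(\<lambda>t. f (X t \<omega>)) \<in> borel_measurable L" by simp
  qed (simp add: M)
  have as_L: "(LINT t:{0..T}|lborel. f (X t \<omega>)) = (\<integral>t. f (X t \<omega>) \<partial>L)" for \<omega>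
    unfolding set_lebesgue_integral_def L_def by (subst integral_restrict_space) auto
  have "path.expectation (\<lambda>\<omega>. \<integral>t. f (X t \<omega>) \<partial>L) = (\<integral>t. path.expectation (\<lambda>\<omega>. f (X t \<omega>)) \<partial>L)"
    by (intro LM.Fubini_integral PM.integrable_const_bound[where B = M]) (auto simp: M case_prod_beta)
  also have "\<dots> = (\<integral>t. m \<partial>L)"
    unfolding m_def
    by (intro Bochner_Integration.integral_cong refl expectation_position f) (simp add: space_L)
  also have "\<dots> = T * m"
    by (simp add: measure_L)
  finally have mean: "path.expectation (\<lambda>\<omega>. \<integral>t. f (X t \<omega>) \<partial>L) = T * m" .
  have "path.variance (\<lambda>\<omega>. \<integral>t. f (X t \<omega>) \<partial>L) =
      path.expectation (\<lambda>\<omega>. (\<integral>t. f (X t \<omega>) - m \<partial>L)\<^sup>2)"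
    unfolding mean
    by (intro Bochner_Integration.integral_cong refl) (simp add: int measure_L)
  also have "\<dots> = (\<integral>s. (\<integral>t. path.expectation (\<lambda>\<omega>. (f (X s \<omega>) - m) * (f (X t \<omega>) - m)) \<partial>L) \<partial>L)"
  proof (rule second_moment_of_integral[OF L.finite_measure_axioms path.finite_measure_axioms])
    have "(\<lambda>z. (\<lambda>(t, \<omega>). f (X t \<omega>)) z - m) \<in> borel_measurable (L \<Otimes>\<^sub>M path_law)"
      by measurable
    then show "(\<lambda>(t, \<omega>). f (X t \<omega>) - m) \<in> borel_measurable (L \<Otimes>\<^sub>M path_law)"
      by (simp add: case_prod_beta)
    show "\<bar>f (X t \<omega>) - m\<bar> \<le> M + \<bar>m\<bar>" for t \<omega>
      using M[of "X t \<omega>"] by linarith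
  qed
  finally show ?thesis by (simp add: as_L)
qed

lemma covariance_eq:
  fixes f :: "'a \<Rightarrow> real"
  defines "m \<equiv> (\<integral>x. f x \<partial>\<mu>)"
  assumes f [measurable]: "f \<in> borel_measurable borel" and M: "\<And>x. \<bar>f x\<bar> \<le> M" and st: "0 \<le> s" "0 \<le> t"
  shows "path.expectation (\<lambda>\<omega>. (f (X s \<omega>) - m) * (f (X t \<omega>) - m)) =
    path.expectation (\<lambda>\<omega>. f (X s \<omega>) * f (X t \<omega>)) - m\<^sup>2"
proof -
  have [measurable]: "X s \<in> path_law \<rightarrow>\<^sub>M borel" "X t \<in> path_law \<rightarrow>\<^sub>M borel"
    using st by (auto intro: measurable_path_position)
  have int: "integrable path_law (\<lambda>\<omega>. f (X s \<omega>))" "integrable path_law (\<lambda>\<omega>. f (X t \<omega>))"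
    by (auto intro!: path.integrable_const_bound[where B = M] simp: M)
  have int2: "integrable path_law (\<lambda>\<omega>. f (X s \<omega>) * f (X t \<omega>))"
  proof (rule path.integrable_const_bound[where B = "M * M"])
    have "\<bar>f x\<bar> * \<bar>f y\<bar> \<le> M * M" for x y
      by (rule mult_mono) (auto simp: M intro: order_trans[OF abs_ge_zero M])
    then show "AE \<omega> in path_law. norm (f (X s \<omega>) * f (X t \<omega>)) \<le> M * M"
      by (simp add: abs_mult)
  qed measurable
  have "path.expectation (\<lambda>\<omega>. (f (X s \<omega>) - m) * (f (X t \<omega>) - m)) =
      path.expectation (\<lambda>\<omega>. f (X s \<omega>) * f (X t \<omega>) - m * f (X t \<omega>) - m * f (X s \<omega>) + m\<^sup>2)"
    by (intro Bochner_Integration.integral_cong refl) (simp add: algebra_simps power2_eq_square)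
  also have "\<dots> = path.expectation (\<lambda>\<omega>. f (X s \<omega>) * f (X t \<omega>)) - m * m - m * m + m\<^sup>2"
    using int int2 st path.prob_space by (simp add: expectation_position f m_def)
  finally show ?thesis by (simp add: power2_eq_square)
qed

text \<open>
  The product \<open>f(X\<^sub>s) f(X\<^sub>s\<^sub>+\<^sub>v)\<close> vanishes unless both positions lie in \<open>S\<close>. The first lies there with
  probability \<open>\<mu>(S)\<close>, and from any starting point the second does with probability at most \<open>h\<close>.
\<close>

lemma correlation_le_kernel_bound:
  fixes f :: "'a \<Rightarrow> real"
  assumes f [measurable]: "f \<in> borel_measurable borel" and M: "\<And>x. \<bar>f x\<bar> \<le> M"
    and S [measurable]: "S \<in> sets borel" and supp: "\<And>x. x \<notin> S \<Longrightarrow> f x = 0"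
    and sv: "0 \<le> s" "0 \<le> v" and h: "0 \<le> h" "\<And>x. emeasure (transition X P v x) S \<le> ennreal h"
  shows "path.expectation (\<lambda>\<omega>. f (X s \<omega>) * f (X (s + v) \<omega>)) \<le> M\<^sup>2 * (h * measure \<mu> S)"
proof (rule integral_real_bounded)
  have M0: "0 \<le> M" by (rule order_trans[OF abs_ge_zero M])
  have [measurable]: "X s \<in> path_law \<rightarrow>\<^sub>M borel" "X (s + v) \<in> path_law \<rightarrow>\<^sub>M borel"
    using sv by (auto intro: measurable_path_position)
  let ?E = "{\<omega>\<in>W. X s \<omega> \<in> S \<and> X (s + v) \<omega> \<in> S}"
  have [measurable]: "?E \<in> sets path_law"
  proof -
    have "{\<omega>\<in>space path_law. X s \<omega> \<in> S \<and> X (s + v) \<omega> \<in> S} \<in> sets path_law" by measurable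
    then show ?thesis by simp
  qed
  have ff: "f x * f y \<le> M\<^sup>2 * (indicator S x * indicator S y)" for x y
  proof (cases "x \<in> S \<and> y \<in> S")
    case True
    have "f x * f y \<le> \<bar>f x\<bar> * \<bar>f y\<bar>" by (simp flip: abs_mult)
    also have "\<dots> \<le> M * M" by (intro mult_mono M M0) simp
    finally show ?thesis using True by (simp add: power2_eq_square)
  qed (auto simp: supp)
  have "emeasure path_law ?E = (\<integral>\<^sup>+x\<in>S. emeasure (transition X P v x) S \<partial>\<mu>)"
    by (rule path_two_times[OF sv S S])
  also have "\<dots> \<le> (\<integral>\<^sup>+x. ennreal h * indicator S x \<partial>\<mu>)"
    by (intro nn_integral_mono mult_right_mono h) simp
  also have "\<dots> = ennreal (h * measure \<mu> S)"
    using h by (simp add: nn_integral_cmult initial.emeasure_eq_measure ennreal_mult)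
  finally have pair: "emeasure path_law ?E \<le> ennreal (h * measure \<mu> S)" .
  have "(\<integral>\<^sup>+\<omega>. ennreal (f (X s \<omega>) * f (X (s + v) \<omega>)) \<partial>path_law) \<le>
      (\<integral>\<^sup>+\<omega>. ennreal (M\<^sup>2) * indicator ?E \<omega> \<partial>path_law)"
  proof (rule nn_integral_mono)
    fix \<omega> assume "\<omega> \<in> space path_law"
    then have "ennreal (M\<^sup>2 * (indicator S (X s \<omega>) * indicator S (X (s + v) \<omega>))) =
        ennreal (M\<^sup>2) * indicator ?E \<omega>"
      by (auto simp: indicator_def)
    with ff[THEN ennreal_leI, of "X s \<omega>" "X (s + v) \<omega>"]
    show "ennreal (f (X s \<omega>) * f (X (s + v) \<omega>)) \<le> ennreal (M\<^sup>2) * indicator ?E \<omega>"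
      by simp
  qed
  also have "\<dots> = ennreal (M\<^sup>2) * emeasure path_law ?E"
    by (simp add: nn_integral_cmult)
  also have "\<dots> \<le> ennreal (M\<^sup>2) * ennreal (h * measure \<mu> S)"
    by (intro mult_left_mono pair) simp
  also have "\<dots> = ennreal (M\<^sup>2 * (h * measure \<mu> S))"
    using h by (simp add: ennreal_mult)
  finally show "(\<integral>\<^sup>+\<omega>. ennreal (f (X s \<omega>) * f (X (s + v) \<omega>)) \<partial>path_law) \<le> ennreal (M\<^sup>2 * (h * measure \<mu> S))" .
qed (use h in simp)

text \<open>
  Both terms on the left are integrals of \<open>f(x) f(y)\<close> against a density with respect to the product
  of \<open>\<mu>\<close> and Lebesgue measure: \<open>p\<^sub>v(x,y)\<close> for the correlation and \<open>\<rho>(y)\<close> for the squared mean. On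
  \<open>S \<times> S\<close> the densities differ by at most \<open>R\<close>, up to the \<open>\<mu>\<close>-null set of \<open>x\<close> outside \<open>\<Lambda>\<close>.
\<close>

lemma covariance_le_density_distance:
  fixes f :: "'a \<Rightarrow> real" and \<rho> :: "'a \<Rightarrow> real"
  assumes f [measurable]: "f \<in> borel_measurable borel" and M: "\<And>x. \<bar>f x\<bar> \<le> M"
    and S [measurable]: "S \<in> sets borel" and supp: "\<And>x. x \<notin> S \<Longrightarrow> f x = 0"
    and fin: "emeasure lborel S < \<infinity>"
    and sv: "0 \<le> s" "0 < v" and dens: "transition_density (transition X P) p"
    and \<rho> [measurable]: "\<rho> \<in> borel_measurable borel" and \<rho>_nonneg: "\<And>x. 0 \<le> \<rho> x"
    and \<mu>: "\<mu> = density lborel (\<lambda>x. ennreal (\<rho> x))"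
    and \<Lambda> [measurable]: "\<Lambda> \<in> sets borel" and full: "emeasure \<mu> \<Lambda> = 1"
    and R: "0 \<le> R" "\<And>x y. x \<in> S \<inter> \<Lambda> \<Longrightarrow> y \<in> S \<Longrightarrow> \<bar>p v x y - \<rho> y\<bar> \<le> R"
  shows "path.expectation (\<lambda>\<omega>. f (X s \<omega>) * f (X (s + v) \<omega>)) - (\<integral>x. f x \<partial>\<mu>)\<^sup>2
    \<le> M\<^sup>2 * (R * (measure \<mu> S * measure lborel S))"
proof -
  have M0: "0 \<le> M" by (rule order_trans[OF abs_ge_zero M])
  let ?Q = "\<mu> \<Otimes>\<^sub>M (lborel :: 'a measure)"
  interpret Q: pair_sigma_finite \<mu> "lborel :: 'a measure" ..
  have [measurable]: "X s \<in> path_law \<rightarrow>\<^sub>M borel" "X (s + v) \<in> path_law \<rightarrow>\<^sub>M borel"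
    using sv by (auto intro: measurable_path_position)
  have sets_Q: "sets ?Q = sets (borel \<Otimes>\<^sub>M (borel :: 'a measure))"
    by (intro sets_pair_measure_cong) auto
  have p_meas [measurable]: "(\<lambda>(x, y). p v x y) \<in> borel_measurable (borel \<Otimes>\<^sub>M borel)"
    and p_nonneg: "0 \<le> p v x y" for x y
    using dens sv by (auto simp: transition_density_def)
  have [measurable]: "(\<lambda>z. p v (fst z) (snd z)) \<in> borel_measurable (borel \<Otimes>\<^sub>M borel)"
    using p_meas by (simp add: case_prod_beta)
  note cong = measurable_cong_sets[OF sets_Q refl]
  let ?g = "\<lambda>z. f (fst z) * f (snd z)"
  let ?p = "\<lambda>z. p v (fst z) (snd z) * ?g z"
  let ?\<rho> = "\<lambda>z. \<rho> (snd z) * ?g z"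
  have g_bound: "\<bar>?g z\<bar> \<le> M\<^sup>2 * indicator (S \<times> S) z" for z
  proof (cases "z \<in> S \<times> S")
    case True
    have "\<bar>f (fst z)\<bar> * \<bar>f (snd z)\<bar> \<le> M * M" by (intro mult_mono M M0) simp
    with True show ?thesis by (simp add: abs_mult power2_eq_square)
  qed (auto simp: supp indicator_def mem_Times_iff)
  have law: "distr path_law (borel \<Otimes>\<^sub>M borel) (\<lambda>\<omega>. (X s \<omega>, X (s + v) \<omega>)) =
      density ?Q (\<lambda>z. ennreal (p v (fst z) (snd z)))"
    using pair_law[OF sv dens] by (simp add: case_prod_unfold)
  have int_path: "integrable path_law (\<lambda>\<omega>. ?g (X s \<omega>, X (s + v) \<omega>))"
  proof (rule path.integrable_const_bound[where B = "M\<^sup>2"])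
    have "\<bar>?g z\<bar> \<le> M\<^sup>2" for z
      using g_bound[of z] by (auto simp: indicator_def split: if_splits intro: order_trans)
    then show "AE \<omega> in path_law. norm (?g (X s \<omega>, X (s + v) \<omega>)) \<le> M\<^sup>2"
      by (simp only: real_norm_def) simp
  qed measurable
  have "integrable (density ?Q (\<lambda>z. ennreal (p v (fst z) (snd z)))) ?g"
    unfolding law[symmetric] by (subst integrable_distr_eq) (use int_path in auto)
  then have int_p: "integrable ?Q ?p"
    by (subst (asm) integrable_real_density) (auto simp: cong p_nonneg)
  have "path.expectation (\<lambda>\<omega>. f (X s \<omega>) * f (X (s + v) \<omega>)) =
      (\<integral>z. ?g z \<partial>distr path_law (borel \<Otimes>\<^sub>M borel) (\<lambda>\<omega>. (X s \<omega>, X (s + v) \<omega>)))"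
    by (subst integral_distr) auto
  also have "\<dots> = (\<integral>z. ?p z \<partial>?Q)"
    unfolding law by (subst integral_real_density) (auto simp: cong p_nonneg)
  finally have corr: "path.expectation (\<lambda>\<omega>. f (X s \<omega>) * f (X (s + v) \<omega>)) = (\<integral>z. ?p z \<partial>?Q)" .
  have [measurable]: "\<Lambda> \<in> sets \<mu>" by simp
  have "AE x in \<mu>. x \<in> \<Lambda>"
    using initial.AE_in_set_eq_1[of \<Lambda>] full by (simp add: initial.emeasure_eq_measure)
  then have "AE x in \<mu>. AE y in (lborel :: 'a measure). fst (x, y) \<in> \<Lambda>"
    by (rule eventually_mono) simp
  then have "AE z in ?Q. fst z \<in> \<Lambda>"
    by (rule Q.AE_pair_measure[rotated]) measurable
  then have diff_bound: "AE z in ?Q. \<bar>?p z - ?\<rho> z\<bar> \<le> M\<^sup>2 * R * indicator (S \<times> S) z"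
  proof eventually_elim
    case (elim z)
    show ?case
    proof (cases "z \<in> S \<times> S")
      case True
      have "\<bar>?p z - ?\<rho> z\<bar> = \<bar>p v (fst z) (snd z) - \<rho> (snd z)\<bar> * \<bar>?g z\<bar>"
        by (simp only: left_diff_distrib abs_mult[symmetric])
      also have "\<dots> \<le> R * M\<^sup>2"
      proof (rule mult_mono)
        show "\<bar>p v (fst z) (snd z) - \<rho> (snd z)\<bar> \<le> R"
          by (rule R(2)) (use True elim in auto)
        show "\<bar>?g z\<bar> \<le> M\<^sup>2"
          using g_bound[of z] True by simp
      qed (use R(1) in simp_all)
      finally show ?thesis using True by (simp add: mult.commute)
    qed (auto simp: supp mem_Times_iff)
  qed
  have SS: "emeasure ?Q (S \<times> S) = ennreal (measure \<mu> S * measure lborel S)"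
    using fin by (simp add: lborel.emeasure_pair_measure_Times initial.emeasure_eq_measure
        emeasure_eq_ennreal_measure ennreal_mult)
  have int_bound: "integrable ?Q (\<lambda>z. M\<^sup>2 * R * indicator (S \<times> S) z)"
    using SS by (intro integrable_mult_right integrable_real_indicator) (auto simp: sets_Q)
  have int_diff: "integrable ?Q (\<lambda>z. ?p z - ?\<rho> z)"
    by (rule Bochner_Integration.integrable_bound[OF int_bound])
       (use diff_bound in \<open>auto simp: cong elim!: eventually_mono intro: order_trans\<close>)
  (* This integrand may be unbounded; it is integrable as a difference of integrable functions. *)
  have int_\<rho>: "integrable ?Q ?\<rho>"
    using Bochner_Integration.integrable_diff[OF int_p int_diff] by simp
  have "(\<integral>z. ?\<rho> z \<partial>?Q) = (\<integral>x. (\<integral>y. ?\<rho> (x, y) \<partial>lborel) \<partial>\<mu>)"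
    by (rule Q.integral_fst'[OF int_\<rho>, symmetric])
  also have "\<dots> = (\<integral>x. f x * (\<integral>y. \<rho> y * f y \<partial>lborel) \<partial>\<mu>)"
    by (simp add: mult.left_commute[of "\<rho> _"])
  also have "(\<integral>y. \<rho> y * f y \<partial>lborel) = (\<integral>y. f y \<partial>\<mu>)"
    unfolding \<mu> by (subst integral_real_density) (auto simp: \<rho>_nonneg)
  finally have mean: "(\<integral>z. ?\<rho> z \<partial>?Q) = (\<integral>x. f x \<partial>\<mu>)\<^sup>2"
    by (simp add: power2_eq_square)
  have "(\<integral>z. ?p z \<partial>?Q) - (\<integral>z. ?\<rho> z \<partial>?Q) = (\<integral>z. ?p z - ?\<rho> z \<partial>?Q)"
    by (rule Bochner_Integration.integral_diff[OF int_p int_\<rho>, symmetric])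
  also have "\<dots> \<le> (\<integral>z. M\<^sup>2 * R * indicator (S \<times> S) z \<partial>?Q)"
    by (rule integral_mono_AE[OF int_diff int_bound])
       (rule eventually_mono[OF diff_bound], linarith)
  also have "\<dots> = M\<^sup>2 * (R * (measure \<mu> S * measure lborel S))"
    using SS by (simp add: measure_eq_emeasure_eq_ennreal sets_Q)
  finally show ?thesis unfolding corr mean .
qed

end

section \<open>The variance bound\<close>

lemma emeasure_transition_le_density_bound:
  assumes dens: "transition_density K p" and v: "0 < v" and S [measurable]: "S \<in> sets borel"
    and c: "0 \<le> c" "\<And>y. p v x y \<le> c"
  shows "emeasure (K v x) S \<le> ennreal c * emeasure lborel S"
proof -
  have "emeasure (K v x) S = (\<integral>\<^sup>+y\<in>S. ennreal (p v x y) \<partial>lborel)"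
    using dens v S by (simp add: transition_density_def)
  also have "\<dots> \<le> (\<integral>\<^sup>+y. ennreal c * indicator S y \<partial>lborel)"
    using c by (intro nn_integral_mono mult_right_mono ennreal_leI) auto
  also have "\<dots> = ennreal c * emeasure lborel S"
    by (simp add: nn_integral_cmult)
  finally show ?thesis .
qed

theorem proposition2p1:
  fixes W :: "'w set"
    and X :: "real \<Rightarrow> 'w \<Rightarrow> 'a::euclidean_space"
    and P :: "'a \<Rightarrow> 'w measure"
    and p :: "real \<Rightarrow> 'a \<Rightarrow> 'a \<Rightarrow> real"
    and \<mu> :: "'a measure"
    and \<rho> :: "'a \<Rightarrow> real"
    and \<Lambda> :: "'a set"
    and r :: "'a set \<Rightarrow> real \<Rightarrow> real"
  assumes "borel_right_process W X P"
    and "transition_density (transition X P) p"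
    and "invariant_law (transition X P) \<mu>"
    and "\<And>\<nu>. invariant_law (transition X P) \<nu> \<Longrightarrow> \<nu> = \<mu>"
    and "\<rho> \<in> borel_measurable borel" and "\<And>x. 0 \<le> \<rho> x"
    and "\<mu> = density lborel (\<lambda>x. ennreal (\<rho> x))"
    and "short_time_density_bound p"
    and "local_uniform_density_convergence \<mu> \<rho> p \<Lambda> r"
  shows "\<exists>C>0. \<forall>(f :: 'a \<Rightarrow> real) S T.
    f \<in> borel_measurable borel \<and> bounded (range f) \<and>
    S = closure {x. f x \<noteq> 0} \<and> compact S \<and> measure lborel S < 1 \<and> 0 < T \<longrightarrow>
      prob_space.variance (\<mu> \<bind> P) (\<lambda>\<omega>. LINT t:{0..T}|lborel. f (X t \<omega>))
        \<le> C * max 1 (convergence_constant r S) * T * (SUP x. \<bar>f x\<bar>)\<^sup>2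
            * measure lborel S * measure \<mu> S * (psi DIM('a) (measure lborel S))\<^sup>2"
proof -
  interpret stationary_right_process W X P \<mu>
    using assms(1,3) by (simp add: stationary_right_process_def stationary_right_process_axioms_def)
  note dens = assms(2)
  obtain A where A: "0 \<le> A" and potential:
    "\<And>l. 0 \<le> l \<Longrightarrow> l < 1 \<Longrightarrow> \<exists>h. h \<in> borel_measurable borel \<and> (\<forall>v. 0 \<le> h v) \<and>
      (\<forall>v\<in>{0<..1}. 1 \<le> h v \<or> (\<exists>K\<ge>0. K * l \<le> h v \<and> (\<forall>x y. p v x y \<le> K))) \<and>
      (\<integral>\<^sup>+v\<in>{0<..1}. ennreal (h v) \<partial>lborel) \<le> ennreal (A * (l * (psi DIM('a) l)\<^sup>2))"
    by (rule short_time_potential_bound[OF assms(8)]) (rule that)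
  have bound: "path.variance (\<lambda>\<omega>. LINT t:{0..T}|lborel. f (X t \<omega>))
      \<le> 2 * (A + 1) * max 1 (convergence_constant r S) * T * (SUP x. \<bar>f x\<bar>)\<^sup>2
          * measure lborel S * measure \<mu> S * (psi DIM('a) (measure lborel S))\<^sup>2"
    if f: "f \<in> borel_measurable borel" "bounded (range f)" and S_eq: "S = closure {x. f x \<noteq> 0}"
      and S: "compact S" "measure lborel S < 1" and T: "0 < T" for f :: "'a \<Rightarrow> real" and S T
  proof -
    define M l m c where "M = (SUP x. \<bar>f x\<bar>)" and "l = measure lborel S"
      and "m = (\<integral>x. f x \<partial>\<mu>)" and "c = convergence_constant r S"
    have "bdd_above (range (\<lambda>x. \<bar>f x\<bar>))"
      using f(2) by (auto simp: bounded_iff bdd_above_def)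
    then have M: "\<bar>f x\<bar> \<le> M" for x
      unfolding M_def by (rule cSUP_upper[OF UNIV_I])
    have S_borel: "S \<in> sets borel" using S(1) by (simp add: borel_compact)
    have supp: "f x = 0" if "x \<notin> S" for x
      using that closure_subset[of "{x. f x \<noteq> 0}"] by (auto simp: S_eq)
    have S_fin: "emeasure lborel S < \<infinity>"
      using emeasure_compact_finite[OF S(1)] by simp
    have l: "0 \<le> l" "l < 1" and S_l: "emeasure lborel S = ennreal l"
      using S(2) S_fin by (simp_all add: l_def emeasure_eq_ennreal_measure)
    obtain h where h [measurable]: "h \<in> borel_measurable borel" and h_nonneg: "\<And>v. 0 \<le> h v"
      and h_kernel: "\<And>v. v \<in> {0<..1} \<Longrightarrow> 1 \<le> h v \<or> (\<exists>K\<ge>0. K * l \<le> h v \<and> (\<forall>x y. p v x y \<le> K))"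
      and h_int: "(\<integral>\<^sup>+v\<in>{0<..1}. ennreal (h v) \<partial>lborel) \<le> ennreal (A * (l * (psi DIM('a) l)\<^sup>2))"
      using potential[OF l] by blast
    define b where "b v = indicator {1<..} v * r S v" for v
    have r: "\<And>t. 0 < t \<Longrightarrow> 0 \<le> r S t"
        "\<And>t x y. 1 < t \<Longrightarrow> x \<in> S \<inter> \<Lambda> \<Longrightarrow> y \<in> S \<Longrightarrow> \<bar>p t x y - \<rho> y\<bar> \<le> r S t"
        "set_integrable lborel {1<..} (r S)"
      using assms(9) S(1) unfolding local_uniform_density_convergence_def by auto
    have \<Lambda>: "\<Lambda> \<in> sets borel" "emeasure \<mu> \<Lambda> = 1"
      using assms(9) by (auto simp: local_uniform_density_convergence_def)
    have b_nonneg: "0 \<le> b v" for v using r(1) by (auto simp: b_def indicator_def)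
    have b_int: "integrable lborel b" and c_eq: "c = (\<integral>v. b v \<partial>lborel)"
      using r(3) by (simp_all add: b_def[abs_def] c_def convergence_constant_def set_integrable_def set_lebesgue_integral_def)
    then have [measurable]: "b \<in> borel_measurable borel"
      using borel_measurable_integrable by fastforce
    have c_nonneg: "0 \<le> c" unfolding c_eq by (simp add: b_nonneg)
    (* G is split at lag one; b carries the cut-off to lags above one. *)
    define G where "G v = ennreal (M\<^sup>2 * measure \<mu> S) * (ennreal (h v) * indicator {0<..1} v + ennreal (l * b v))" for v
    have cov: "ennreal (path.expectation (\<lambda>\<omega>. (f (X s \<omega>) - m) * (f (X (s + v) \<omega>) - m))) \<le> G v"
      if sv: "0 \<le> s" "0 < v" for s v
    proof (cases "v \<le> 1")
      case True
      have v: "v \<in> {0<..1}" using True sv by simp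
      have kernel: "emeasure (transition X P v x) S \<le> ennreal (h v)" for x
        using h_kernel[OF v]
      proof (elim disjE exE conjE)
        assume "1 \<le> h v"
        interpret K: prob_space "transition X P v x"
          using sv by (intro prob_space_transition) simp
        show ?thesis using order_trans[OF K.prob_le_1 \<open>1 \<le> h v\<close>] by (simp add: K.emeasure_eq_measure ennreal_leI)
      next
        fix K assume K: "0 \<le> K" "K * l \<le> h v" "\<forall>x y. p v x y \<le> K"
        then show ?thesis
          using emeasure_transition_le_density_bound[OF dens sv(2) S_borel K(1), of x] l
          by (simp add: S_l ennreal_mult[symmetric]) (meson ennreal_leI order_trans)
      qed
      (* Here the centring term is negative and may be dropped. *)
      have "path.expectation (\<lambda>\<omega>. (f (X s \<omega>) - m) * (f (X (s + v) \<omega>) - m))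
          \<le> path.expectation (\<lambda>\<omega>. f (X s \<omega>) * f (X (s + v) \<omega>))"
        unfolding m_def using sv by (subst covariance_eq[OF f(1) M]) auto
      also have "\<dots> \<le> M\<^sup>2 * (h v * measure \<mu> S)"
        using sv by (intro correlation_le_kernel_bound f M S_borel supp h_nonneg kernel) auto
      finally show ?thesis
        using True sv h_nonneg by (auto simp: G_def b_def ennreal_mult[symmetric] ac_simps intro: ennreal_leI)
    next
      case False
      have "path.expectation (\<lambda>\<omega>. (f (X s \<omega>) - m) * (f (X (s + v) \<omega>) - m)) =
          path.expectation (\<lambda>\<omega>. f (X s \<omega>) * f (X (s + v) \<omega>)) - m\<^sup>2"
        unfolding m_def using sv by (intro covariance_eq[OF f(1) M]) auto
      also have "\<dots> \<le> M\<^sup>2 * (r S v * (measure \<mu> S * measure lborel S))"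
        unfolding m_def using False
        by (intro covariance_le_density_distance[OF f(1) M S_borel supp S_fin sv dens assms(5,6,7) \<Lambda>] r) auto
      also have "\<dots> = (M\<^sup>2 * measure \<mu> S) * (l * b v)"
        using False by (simp add: b_def l_def)
      finally have "ennreal (path.expectation (\<lambda>\<omega>. (f (X s \<omega>) - m) * (f (X (s + v) \<omega>) - m)))
          \<le> ennreal ((M\<^sup>2 * measure \<mu> S) * (l * b v))"
        by (rule ennreal_leI)
      then show ?thesis
        using False l b_nonneg by (simp add: G_def ennreal_mult)
    qed
    define K where "K = M\<^sup>2 * measure \<mu> S * ((A + 1) * max 1 c * (l * (psi DIM('a) l)\<^sup>2))"
    have K_nonneg: "0 \<le> K" using A l by (simp add: K_def)
    have "(\<integral>\<^sup>+v\<in>{0<..}. G v \<partial>lborel) \<le>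
        (\<integral>\<^sup>+v. ennreal (M\<^sup>2 * measure \<mu> S) * (ennreal (h v) * indicator {0<..1} v + ennreal (l * b v)) \<partial>lborel)"
      by (intro nn_integral_mono) (auto simp: G_def indicator_def)
    also have "\<dots> = ennreal (M\<^sup>2 * measure \<mu> S) *
        ((\<integral>\<^sup>+v\<in>{0<..1}. ennreal (h v) \<partial>lborel) + (\<integral>\<^sup>+v. ennreal (l * b v) \<partial>lborel))"
      by (simp add: nn_integral_cmult nn_integral_add)
    also have "(\<integral>\<^sup>+v. ennreal (l * b v) \<partial>lborel) = ennreal (l * c)"
      using b_int b_nonneg l by (subst nn_integral_eq_integral) (auto simp: c_eq)
    also have "ennreal (M\<^sup>2 * measure \<mu> S) * ((\<integral>\<^sup>+v\<in>{0<..1}. ennreal (h v) \<partial>lborel) + ennreal (l * c))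
        \<le> ennreal (M\<^sup>2 * measure \<mu> S) * (ennreal (A * (l * (psi DIM('a) l)\<^sup>2)) + ennreal (l * c))"
      by (intro mult_left_mono add_right_mono h_int) simp
    also have "\<dots> = ennreal (M\<^sup>2 * measure \<mu> S * (A * (l * (psi DIM('a) l)\<^sup>2) + l * c))"
      using A l c_nonneg by (simp add: ennreal_mult)
    also have "\<dots> \<le> ennreal K"
    proof (unfold K_def, intro ennreal_leI mult_left_mono)
      have "l * c \<le> (l * (psi DIM('a) l)\<^sup>2) * max 1 c"
        using le_times_psi_squared[OF l, of "DIM('a)"] c_nonneg l by (intro mult_mono) auto
      moreover have "A * (l * (psi DIM('a) l)\<^sup>2) * 1 \<le> A * (l * (psi DIM('a) l)\<^sup>2) * max 1 c"
        using A l by (intro mult_left_mono) auto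
      ultimately show "A * (l * (psi DIM('a) l)\<^sup>2) + l * c \<le> (A + 1) * max 1 c * (l * (psi DIM('a) l)\<^sup>2)"
        by (simp add: algebra_simps)
    qed simp
    finally have G_int: "(\<integral>\<^sup>+v\<in>{0<..}. G v \<partial>lborel) \<le> ennreal K" .
    let ?L = "restrict_space lborel {0..T}"
    have "path.variance (\<lambda>\<omega>. LINT t:{0..T}|lborel. f (X t \<omega>)) =
        (\<integral>s. (\<integral>t. path.expectation (\<lambda>\<omega>. (f (X s \<omega>) - m) * (f (X t \<omega>) - m)) \<partial>?L) \<partial>?L)"
      unfolding m_def by (rule variance_time_integral[OF f(1) M]) (use T in simp)
    also have "\<dots> \<le> 2 * T * K"
    proof (rule integral_difference_kernel_le[OF _ _ K_nonneg G_int])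
      show "G \<in> borel_measurable borel" unfolding G_def by measurable
      fix s t :: real assume st: "0 \<le> s" "0 \<le> t" "s \<noteq> t"
      show "ennreal (path.expectation (\<lambda>\<omega>. (f (X s \<omega>) - m) * (f (X t \<omega>) - m))) \<le> G \<bar>t - s\<bar>"
      proof (cases "s < t")
        case True
        then show ?thesis using cov[of s "t - s"] st by simp
      next
        case False
        then show ?thesis using cov[of t "s - t"] st by (simp add: mult.commute)
      qed
    qed (use T in simp)
    finally show ?thesis by (simp only: K_def M_def l_def c_def ac_simps)
  qed
  show ?thesis
    using A bound by (intro exI[of _ "2 * (A + 1)"]) auto
qed

end
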